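(* There exists a vector $\pmb{\theta}=(\theta_1,\theta_2)\in\mathbb{R}^2$ such that both of the following hold: 1) $1,\theta_1,\theta_2$ are linearly independent over $\mathbb{Z}$; 2) the set $$ \mathrm{Bad}_{\pmb{\theta}} := \Big\{(\eta_1,\eta_2)\in\mathbb{R}^2 :\ \inf_{x\in\mathbb{N}} x^{1/2}\max_{i=1,2}\|x\theta_i-\eta_i\|>0\Big\} $$ is not isotropically winning (as a subset of $\mathbb{R}^2$).
   Context: Here $\|\cdot\|$ denotes the distance from a real number to the nearest integer, and $\mathbb{N}=\{1,2,3,\dots\}$. Schmidt's game. Let $0<\alpha,\beta<1$ and let $\mathcal{A}$ be a Euclidean space (either $\mathbb{R}^n$, or a $d$-dimensional affine subspace of $\mathbb{R}^n$ with $d\ge 1$ and the induced Euclidean metric). Two players A and B choose in turn, with B moving first, closed balls of $\mathcal{A}$ (of positive radius) forming a nested sequence $$B_1\supset A_1\supset B_2\supset A_2\supset\cdots,$$ where B chooses the balls $B_i$, A chooses the balls $A_i$, and the diameters satisfy $|A_i|=\alpha|B_i|$ and $|B_{i+1}|=\beta|A_i|$ for all $i=1,2,3,\dots$ (the initial ball $B_1$ is an arbitrary closed ball chosen by B). A set $E\subset\mathcal{A}$ is called $(\alpha,\beta)$-winning if player A has a strategy which guarantees that $\bigcap_i A_i$ meets $E$ regardless of how B plays. It is called $\alpha$-winning if it is $(\alpha,\beta)$-winning for all $0<\beta<1$. Isotropically winning sets. A set $E\subset\mathbb{R}^n$ is called isotropically winning if for each $d$ with $1\le d\le n$ and each $d$-dimensional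 affine subspace $\mathcal{A}\subset\mathbb{R}^n$, the intersection $E\cap\mathcal{A}$ is $1/2$-winning for Schmidt's game considered as a game in $\mathcal{A}$. *)

theory Defs
  imports "HOL-Analysis.Analysis"
begin

section \<open>Schmidt's game\<close>

definition ball_in :: "'a::euclidean_space set \<Rightarrow> 'a set \<Rightarrow> bool" where
  "ball_in \<A> S \<longleftrightarrow> (\<exists>c\<in>\<A>. \<exists>r>0. S = cball c r \<inter> \<A>)"

text \<open>Rounds are numbered from 0: round \<open>n\<close> consists of the move \<open>B n\<close> followed by the move \<open>A n\<close>.\<close>

definition legal_B :: "real \<Rightarrow> 'a::euclidean_space set \<Rightarrow> (nat \<Rightarrow> 'a set) \<Rightarrow> (nat \<Rightarrow> 'a set) \<Rightarrow> nat \<Rightarrow> bool" where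
  "legal_B \<beta> \<A> B A n \<longleftrightarrow> ball_in \<A> (B n) \<and>
     (\<forall>m. n = Suc m \<longrightarrow> B n \<subseteq> A m \<and> diameter (B n) = \<beta> * diameter (A m))"

definition legal_A :: "real \<Rightarrow> 'a::euclidean_space set \<Rightarrow> (nat \<Rightarrow> 'a set) \<Rightarrow> (nat \<Rightarrow> 'a set) \<Rightarrow> nat \<Rightarrow> bool" where
  "legal_A \<alpha> \<A> B A n \<longleftrightarrow> ball_in \<A> (A n) \<and> A n \<subseteq> B n \<and> diameter (A n) = \<alpha> * diameter (B n)"

text \<open>
  A strategy of player A maps the list of all moves made so far by B to A's next move; A's own
  earlier moves are determined by the strategy and this list.  It must answer legally
  after every finite sequence of legal moves of B: otherwise A could win vacuously by an illegal
  move, such as the empty set, to which B has no legal answer.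
\<close>

definition strategy_moves :: "('a set list \<Rightarrow> 'a set) \<Rightarrow> (nat \<Rightarrow> 'a set) \<Rightarrow> nat \<Rightarrow> 'a set" where
  "strategy_moves \<sigma> B n = \<sigma> (map B [0..<Suc n])"

definition winning_strategy ::
    "real \<Rightarrow> real \<Rightarrow> 'a::euclidean_space set \<Rightarrow> 'a set \<Rightarrow> ('a set list \<Rightarrow> 'a set) \<Rightarrow> bool" where
  "winning_strategy \<alpha> \<beta> \<A> E \<sigma> \<longleftrightarrow>
     (\<forall>B. let A = strategy_moves \<sigma> B in
        (\<forall>n. (\<forall>i\<le>n. legal_B \<beta> \<A> B A i) \<longrightarrow> legal_A \<alpha> \<A> B A n) \<and>
        ((\<forall>n. legal_B \<beta> \<A> B A n) \<longrightarrow> (\<Inter>n. A n) \<inter> E \<noteq> {}))"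

definition alpha_beta_winning :: "real \<Rightarrow> real \<Rightarrow> 'a::euclidean_space set \<Rightarrow> 'a set \<Rightarrow> bool" where
  "alpha_beta_winning \<alpha> \<beta> \<A> E \<longleftrightarrow> (\<exists>\<sigma>. winning_strategy \<alpha> \<beta> \<A> E \<sigma>)"

definition alpha_winning :: "real \<Rightarrow> 'a::euclidean_space set \<Rightarrow> 'a set \<Rightarrow> bool" where
  "alpha_winning \<alpha> \<A> E \<longleftrightarrow> (\<forall>\<beta>. 0 < \<beta> \<and> \<beta> < 1 \<longrightarrow> alpha_beta_winning \<alpha> \<beta> \<A> E)"

definition isotropically_winning :: "'a::euclidean_space set \<Rightarrow> bool" where
  "isotropically_winning E \<longleftrightarrow>
     (\<forall>d \<A>. 1 \<le> d \<and> d \<le> DIM('a) \<and> affine \<A> \<and> aff_dim \<A> = int d \<longrightarrow>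
        alpha_winning (1/2) \<A> (E \<inter> \<A>))"

section \<open>Inhomogeneous badly approximable vectors\<close>

definition dist_int :: "real \<Rightarrow> real" where
  "dist_int x = infdist x \<int>"

definition Bad :: "real ^ 2 \<Rightarrow> (real ^ 2) set" where
  "Bad \<theta> = {\<eta>. (INF x\<in>{1::nat..}. real x powr (1/2) *
       max (dist_int (real x * \<theta> $ 1 - \<eta> $ 1)) (dist_int (real x * \<theta> $ 2 - \<eta> $ 2))) > 0}"

end

theory Submission
  imports Defs "HOL-Analysis.Kronecker_Approximation_Theorem"
begin

text \<open>
  The set \<open>Bad \<theta>\<close> can miss a whole line, namely \<open>\<eta>\<^sub>2 = 0\<close>. Fix an irrational \<open>\<theta>\<^sub>1\<close> and restrict
  to \<open>x = y q\<close> with \<open>1 \<le> y \<le> N\<close>. If \<open>N\<close> is the denominator of a good rational approximation of \<open>q \<theta>\<^sub>1\<close>,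
  the points \<open>y q \<theta>\<^sub>1\<close> are \<open>O(1/N)\<close>-dense modulo 1, which beats \<open>\<epsilon> / sqrt (q N)\<close> as soon as \<open>N\<close> is
  large in terms of \<open>q\<close> and \<open>\<epsilon>\<close>. Since \<open>N\<close> depends only on \<open>\<theta>\<^sub>1\<close>, \<open>q\<close> and \<open>\<epsilon>\<close>, a Liouville-type
  \<open>\<theta>\<^sub>2\<close> makes the second coordinate equally small for suitable \<open>q\<close>; by Baire's theorem it can be
  chosen outside the countable set of numbers that are rationally dependent on 1 and \<open>\<theta>\<^sub>1\<close>.
\<close>

section \<open>Schmidt's game with an empty target set\<close>

lemma diameter_cball_Int_affine:
  fixes c :: "'a::euclidean_space"
  assumes "affine \<A>" "c \<in> \<A>" "d \<in> \<A>" "c \<noteq> d" "0 \<le> r"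
  shows "diameter (cball c r \<inter> \<A>) = 2 * r"
proof (rule antisym)
  show "diameter (cball c r \<inter> \<A>) \<le> 2 * r"
    using diameter_subset[of "cball c r \<inter> \<A>" "cball c r"] assms by simp
  \<comment> \<open>The second point \<open>d\<close> supplies a direction inside
    \<open>\<A>\<close>. Scaled to length \<open>r\<close>, it yields two antipodal points of the
    ball at distance \<open>2 * r\<close>.\<close>
  define s where "s = r / norm (d - c)"
  have ns: "norm (s *\<^sub>R (d - c)) = r"
    using assms by (simp add: s_def)
  have line: "c + u *\<^sub>R (d - c) \<in> \<A>" for u
  proof -
    have "(1 - u) *\<^sub>R c + u *\<^sub>R d \<in> \<A>"
      using assms by (intro mem_affine) auto
    then show ?thesis by (simp add: algebra_simps)
  qed
  have "c + s *\<^sub>R (d - c) \<in> cball c r \<inter> \<A>"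
    using line[of s] ns by (simp add: dist_norm norm_minus_commute)
  moreover have "c - s *\<^sub>R (d - c) \<in> cball c r \<inter> \<A>"
    using line[of "- s"] ns by (simp add: dist_norm norm_minus_commute)
  ultimately have "dist (c + s *\<^sub>R (d - c)) (c - s *\<^sub>R (d - c)) \<le> diameter (cball c r \<inter> \<A>)"
    by (intro diameter_bounded_bound) (auto intro: bounded_Int)
  moreover have "(c + s *\<^sub>R (d - c)) - (c - s *\<^sub>R (d - c)) = 2 *\<^sub>R (s *\<^sub>R (d - c))"
    by (simp add: algebra_simps flip: scaleR_2)
  then have "dist (c + s *\<^sub>R (d - c)) (c - s *\<^sub>R (d - c)) = 2 * r"
    using ns by (simp only: dist_norm norm_scaleR)
  ultimately show "2 * r \<le> diameter (cball c r \<inter> \<A>)" by simp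
qed

text \<open>The concentric ball with radius scaled by \<open>\<beta>\<close> works. Because
  \<open>a \<noteq> b\<close>, some point of \<open>\<A>\<close> differs from its centre, so
  diameters scale like radii.\<close>

lemma ball_in_shrink:
  fixes \<A> :: "'a::euclidean_space set"
  assumes "affine \<A>" "a \<in> \<A>" "b \<in> \<A>" "a \<noteq> b" "0 < \<beta>" "\<beta> < 1" "ball_in \<A> S"
  shows "\<exists>T. ball_in \<A> T \<and> T \<subseteq> S \<and> diameter T = \<beta> * diameter S"
proof -
  obtain c r where c: "c \<in> \<A>" "r > 0" "S = cball c r \<inter> \<A>"
    using assms by (auto simp: ball_in_def)
  obtain d where d: "d \<in> \<A>" "c \<noteq> d" using assms by metis
  have "cball c (\<beta> * r) \<subseteq> cball c r"
    using c assms by (intro subset_cball) (simp add: mult_left_le_one_le)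
  moreover have "diameter (cball c (\<beta> * r) \<inter> \<A>) = \<beta> * diameter S"
    using c d assms by (simp add: diameter_cball_Int_affine)
  ultimately show ?thesis
    using c assms unfolding ball_in_def
    by (intro exI[of _ "cball c (\<beta> * r) \<inter> \<A>"]) (auto intro!: bexI[of _ c] exI[of _ "\<beta> * r"])
qed

text \<open>Against legal answers B never runs out of legal moves, so some infinite legal play
  follows the strategy; winning it would need a point of the empty set.\<close>

lemma not_alpha_beta_winning_empty:
  fixes \<A> :: "'a::euclidean_space set"
  assumes "affine \<A>" "a \<in> \<A>" "b \<in> \<A>" "a \<noteq> b" "0 < \<beta>" "\<beta> < 1"
  shows "\<not> alpha_beta_winning \<alpha> \<beta> \<A> {}"
proof
  assume "alpha_beta_winning \<alpha> \<beta> \<A> {}"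
  then obtain \<sigma> where \<sigma>: "winning_strategy \<alpha> \<beta> \<A> {} \<sigma>"
    by (auto simp: alpha_beta_winning_def)
  \<comment> \<open>B plays any legal shrinking of the last answer; the state of the recursion is B's history,
    because that is what the strategy consumes.\<close>
  define next_ball where
    "next_ball S = (SOME T. ball_in \<A> T \<and> T \<subseteq> S \<and> diameter T = \<beta> * diameter S)" for S
  have next_ball: "ball_in \<A> (next_ball S) \<and> next_ball S \<subseteq> S
      \<and> diameter (next_ball S) = \<beta> * diameter S" if "ball_in \<A> S" for S
    unfolding next_ball_def using ball_in_shrink[OF assms that] by (rule someI_ex)
  define hist where
    "hist = rec_nat [cball a 1 \<inter> \<A>] (\<lambda>_ xs. xs @ [next_ball (\<sigma> xs)])"
  define B where "B n = last (hist n)" for n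
  have hist: "map B [0..<Suc n] = hist n" for n
    by (induction n) (simp_all add: B_def hist_def)
  define A where "A = strategy_moves \<sigma> B"
  have A: "A n = \<sigma> (hist n)" for n
    by (simp only: A_def strategy_moves_def hist)
  have B_Suc: "B (Suc n) = next_ball (A n)" for n
    by (simp add: B_def A) (simp add: hist_def)
  have legal: "legal_A \<alpha> \<A> B A n" if "\<And>i. i \<le> n \<Longrightarrow> legal_B \<beta> \<A> B A i" for n
    using \<sigma> that by (simp add: winning_strategy_def A_def Let_def)
  have "legal_B \<beta> \<A> B A n" for n
  \<comment> \<open>Strong induction: legality of \<open>A m\<close> rests on all moves of B up to
    round \<open>m\<close>.\<close>
  proof (induction n rule: less_induct)
    case (less n)
    show ?case
    proof (cases n)
      case 0
      have "B 0 = cball a 1 \<inter> \<A>" by (simp add: B_def hist_def)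
      then show ?thesis
        using assms(2) 0 by (auto simp: legal_B_def ball_in_def intro!: bexI[of _ a] exI[of _ 1])
    next
      case (Suc m)
      have "legal_A \<alpha> \<A> B A m" using less Suc by (intro legal) auto
      then show ?thesis
        using next_ball[of "A m"] Suc by (simp add: legal_A_def legal_B_def B_Suc)
    qed
  qed
  then show False
    using \<sigma> by (auto simp: winning_strategy_def A_def Let_def)
qed

section \<open>One-dimensional inhomogeneous approximation\<close>

lemma dist_int_le: "dist_int x \<le> \<bar>x - of_int m\<bar>"
  using infdist_le[of "of_int m" \<int> x] by (simp add: dist_int_def dist_real_def)

lemma dist_int_nonneg: "0 \<le> dist_int x"
  by (simp add: dist_int_def infdist_nonneg)

text \<open>As \<open>h\<close> is invertible modulo \<open>k\<close>, some \<open>y * h / k\<close>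
  lies within \<open>1 / (2 * k)\<close> of \<open>t\<close> modulo 1. Replacing
  \<open>h / k\<close> by \<open>\<alpha>\<close> costs at most
  \<open>k * (1 / k^2)\<close>.\<close>

lemma inhomogeneous_approx:
  assumes "(h, k) \<in> approx_set \<alpha>"
  obtains y :: nat where "1 \<le> y" "int y \<le> k" "dist_int (real y * \<alpha> - t) \<le> 3 / (2 * real_of_int k)"
proof -
  have k: "k > 0" "coprime h k" and hk: "\<bar>\<alpha> - of_int h / of_int k\<bar> < 1 / (of_int k)\<^sup>2"
    using assms by (auto simp: approx_set_def)
  define j where "j = round (t * of_int k)"
  \<comment> \<open>\<open>y\<close> solves \<open>y h \<equiv> j (mod k)\<close>, so that \<open>y h / k\<close> is modulo 1 the multiple of \<open>1/k\<close> nearest to \<open>t\<close>.\<close>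
  obtain u v where uv: "u * h + v * k = 1"
    using bezout_int[of h k] k by auto
  \<comment> \<open>Subtracting 1 before reducing and adding it back puts the residue in
    \<open>1..k\<close> rather than \<open>0..k-1\<close>.\<close>
  define y where "y = (u * j - 1) mod k + 1"
  have y: "1 \<le> y" "y \<le> k"
    using k pos_mod_bound[of k "u * j - 1"] by (simp_all add: y_def del: pos_mod_bound)
  define d where "d = (u * j - 1) div k"
  define m where "m = - d * h - v * j"
  have "y = u * j - k * d"
    by (simp add: y_def d_def minus_div_mult_eq_mod [symmetric] mult.commute)
  then have "y * h = (u * j - k * d) * h" by simp
  also have "\<dots> = (u * h) * j - k * d * h"
    by (simp add: algebra_simps)
  also have "u * h = 1 - v * k" using uv by simp
  finally have m: "y * h = j + k * m"
    by (simp add: m_def algebra_simps)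
  have "of_int y * \<alpha> - t - of_int m
      = of_int y * (\<alpha> - of_int h / of_int k) + (of_int j - t * of_int k) / of_int k"
  proof -
    have "of_int y * of_int h = (of_int j + of_int k * of_int m :: real)"
      using arg_cong[OF m, of real_of_int] by simp
    then show ?thesis using k by (simp add: field_simps)
  qed
  moreover have "\<bar>of_int y * (\<alpha> - of_int h / of_int k)\<bar> \<le> 1 / of_int k"
  proof -
    have "\<bar>of_int y * (\<alpha> - of_int h / of_int k)\<bar> \<le> of_int k * (1 / (of_int k)\<^sup>2)"
      unfolding abs_mult using y hk by (intro mult_mono) auto
    then show ?thesis using k by (simp add: power2_eq_square)
  qed
  moreover have "\<bar>(of_int j - t * of_int k) / of_int k\<bar> \<le> 1 / (2 * of_int k)"
    using of_int_round_abs_le[of "t * of_int k"] k by (simp add: j_def field_simps)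
  ultimately have "\<bar>of_int y * \<alpha> - t - of_int m\<bar> \<le> 1 / of_int k + 1 / (2 * of_int k)"
    by (simp only:) (rule order_trans[OF abs_triangle_ineq add_mono])
  also have "\<dots> = 3 / (2 * of_int k)" using k by (simp add: field_simps)
  finally show thesis
    using dist_int_le[of "of_int y * \<alpha> - t" m] y by (intro that[of "nat y"]) auto
qed

text \<open>An irrational \<open>\<alpha>\<close> has good approximations with arbitrarily large
  denominators \<open>k\<close>, and these do not depend on \<open>t\<close>.\<close>

lemma uniform_inhomogeneous_approx:
  assumes "\<alpha> \<notin> \<rat>" "0 < \<epsilon>"
  obtains N :: nat where "N > 0"
    "\<And>t. \<exists>y. 1 \<le> y \<and> y \<le> N \<and> sqrt (real N) * dist_int (real y * \<alpha> - t) < \<epsilon>"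
proof -
  have "infinite (approx_set \<alpha>)" using assms rational_iff_finite_approx_set by blast
  \<comment> \<open>This threshold gives \<open>sqrt k > 2 / \<epsilon>\<close>, so
    \<open>3 / (2 * sqrt k) < 3 * \<epsilon> / 4\<close>.\<close>
  then obtain h k where hk: "(h, k) \<in> approx_set \<alpha>" "k > \<lceil>(2 / \<epsilon>)\<^sup>2\<rceil>"
    using infinite_approx_set by blast
  have k: "k > 0" using hk by (auto simp: approx_set_def)
  have "(2 / \<epsilon>)\<^sup>2 < of_int k" using hk by linarith
  then have "2 / \<epsilon> < sqrt (of_int k)" using real_less_rsqrt by blast
  then have "2 < \<epsilon> * sqrt (of_int k)" using assms by (simp add: field_simps)
  moreover have "sqrt (of_int k) * (3 / (2 * of_int k)) = 3 / (2 * sqrt (of_int k))"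
    using k by (simp add: field_simps)
  ultimately have small: "sqrt (of_int k) * (3 / (2 * of_int k)) < \<epsilon>"
    using k by (simp add: divide_less_eq)
  show thesis
  proof (rule that[of "nat k"])
    show "nat k > 0" using k by simp
    fix t
    obtain y where y: "1 \<le> y" "int y \<le> k" "dist_int (real y * \<alpha> - t) \<le> 3 / (2 * of_int k)"
      using inhomogeneous_approx[OF hk(1)] by blast
    have "sqrt (of_int k) * dist_int (real y * \<alpha> - t) \<le> sqrt (of_int k) * (3 / (2 * of_int k))"
      using y k by (intro mult_left_mono) auto
    also note small
    finally show "\<exists>y. 1 \<le> y \<and> y \<le> nat k \<and> sqrt (real (nat k)) * dist_int (real y * \<alpha> - t) < \<epsilon>"
      using y k by (intro exI[of _ y]) auto
  qed
qed

text \<open>However fast \<open>\<delta>\<close> decays, each approximation condition defines an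
  open set containing all rationals, hence dense. Baire's theorem intersects these countably many
  sets with the complements of the points of \<open>X\<close>.\<close>

lemma exists_Liouville_avoiding_countable:
  fixes \<delta> :: "nat \<Rightarrow> nat \<Rightarrow> real"
  assumes "countable X" "\<And>k q. 0 < q \<Longrightarrow> 0 < \<delta> k q"
  obtains \<theta> where "\<theta> \<notin> X" "\<And>k. \<exists>q>0. \<exists>p. \<bar>real q * \<theta> - of_int p\<bar> < \<delta> k q"
proof -
  define U where "U k = (\<Union>q\<in>{0<..}. \<Union>p. {x. \<bar>real q * x - of_int p\<bar> < \<delta> k q})" for k
  have "open (U k)" for k
    unfolding U_def by (intro open_UN ballI open_Collect_less continuous_intros)
  moreover have "closure (U k) = UNIV" for k
  proof -
    have "x \<in> U k" if x: "x \<in> \<rat>" for x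
    proof -
      obtain p q :: int where "q > 0" "x = of_int p / of_int q"
        using x by (blast elim: Rats_cases')
      then show ?thesis
        unfolding U_def using assms(2)[of "nat q" k]
        by (intro UN_I[of "nat q"] UN_I[of p]) auto
    qed
    then show ?thesis
      using Rats_closure_real closure_mono[of \<rat> "U k"] by auto
  qed
  moreover have "closure (- {x}) = UNIV" for x :: real
    by (simp add: closure_complement)
  ultimately have "UNIV \<subseteq> closure (\<Inter>(range U \<union> (\<lambda>x. - {x}) ` X))"
    using assms(1) by (intro Baire) auto
  then have "\<Inter>(range U \<union> (\<lambda>x. - {x}) ` X) \<noteq> {}" by force
  then obtain \<theta> where \<theta>: "\<theta> \<in> \<Inter>(range U \<union> (\<lambda>x. - {x}) ` X)" by blast
  show thesis
  proof (rule that)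
    show "\<theta> \<notin> X" using \<theta> by blast
    fix k
    have "\<theta> \<in> U k" using \<theta> by blast
    then show "\<exists>q>0. \<exists>p. \<bar>real q * \<theta> - of_int p\<bar> < \<delta> k q"
      by (auto simp: U_def)
  qed
qed

section \<open>A line missed by \<open>Bad \<theta>\<close>\<close>

lemma notin_Bad:
  assumes "\<And>\<epsilon>. 0 < \<epsilon> \<Longrightarrow> \<exists>x\<ge>1. sqrt (real x) * dist_int (real x * \<theta> $ 1 - \<eta> $ 1) < \<epsilon>
      \<and> sqrt (real x) * dist_int (real x * \<theta> $ 2 - \<eta> $ 2) < \<epsilon>"
  shows "\<eta> \<notin> Bad \<theta>"
proof
  define f where "f x = real x powr (1/2) *
       max (dist_int (real x * \<theta> $ 1 - \<eta> $ 1)) (dist_int (real x * \<theta> $ 2 - \<eta> $ 2))" for x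
  assume "\<eta> \<in> Bad \<theta>"
  then have pos: "0 < Inf (f ` {1..})" by (simp add: Bad_def f_def)
  \<comment> \<open>The positive infimum itself is taken as \<open>\<epsilon>\<close>.\<close>
  then obtain x where x: "x \<ge> 1"
      "sqrt (real x) * dist_int (real x * \<theta> $ 1 - \<eta> $ 1) < Inf (f ` {1..})"
      "sqrt (real x) * dist_int (real x * \<theta> $ 2 - \<eta> $ 2) < Inf (f ` {1..})"
    using assms by blast
  have "bdd_below (f ` {1..})"
    by (rule bdd_belowI2[of _ 0]) (auto simp: f_def dist_int_nonneg le_max_iff_disj)
  then have "Inf (f ` {1..}) \<le> f x" using x by (intro cINF_lower) auto
  also have "f x < Inf (f ` {1..})"
    using x by (simp add: f_def powr_half_sqrt max_def)
  finally show False by simp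
qed

text \<open>Uniformity in \<open>t\<close> lets \<open>N\<close> and \<open>\<delta>\<close> be
  fixed before \<open>\<theta>2\<close> and independently of \<open>\<eta> $ 1\<close>, so one
  \<open>\<theta>2\<close> serves the whole line.\<close>

lemma exists_independent_Bad_disjoint_line:
  fixes \<theta>1 :: real
  assumes irr: "\<theta>1 \<notin> \<rat>"
  obtains \<theta>2 where
    "\<And>a b c :: int. of_int a + of_int b * \<theta>1 + of_int c * \<theta>2 = 0 \<Longrightarrow> a = 0 \<and> b = 0 \<and> c = 0"
    "\<And>\<theta> \<eta>. \<theta> $ 1 = \<theta>1 \<Longrightarrow> \<theta> $ 2 = \<theta>2 \<Longrightarrow> \<eta> $ 2 = 0 \<Longrightarrow> \<eta> \<notin> Bad \<theta>"
proof -
  define e where "e k = 1 / real (Suc k)" for k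
  have "\<exists>N>0. \<forall>t. \<exists>y. 1 \<le> y \<and> y \<le> N \<and>
      sqrt (real N) * dist_int (real y * (real q * \<theta>1) - t) < e k / sqrt (real q)"
    if "q > 0" for k q
  proof -
    have "real q * \<theta>1 \<notin> \<rat>"
    proof
      assume "real q * \<theta>1 \<in> \<rat>"
      then have "real q * \<theta>1 / real q \<in> \<rat>" by (intro Rats_divide) auto
      then show False using that irr by simp
    qed
    moreover have "0 < e k / sqrt (real q)" using that by (simp add: e_def)
    ultimately show ?thesis using uniform_inhomogeneous_approx by metis
  qed
  then have "\<forall>k q. \<exists>N. q > 0 \<longrightarrow> N > 0 \<and> (\<forall>t. \<exists>y. 1 \<le> y \<and> y \<le> N \<and>
      sqrt (real N) * dist_int (real y * (real q * \<theta>1) - t) < e k / sqrt (real q))"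
    by blast
  then obtain N :: "nat \<Rightarrow> nat \<Rightarrow> nat" where "\<forall>k q. q > 0 \<longrightarrow> N k q > 0 \<and> (\<forall>t. \<exists>y. 1 \<le> y \<and> y \<le> N k q \<and>
      sqrt (real (N k q)) * dist_int (real y * (real q * \<theta>1) - t) < e k / sqrt (real q))"
    by (simp only: choice_iff) blast
  then have N: "\<And>k q. q > 0 \<Longrightarrow> N k q > 0"
    "\<And>k q t. q > 0 \<Longrightarrow> \<exists>y. 1 \<le> y \<and> y \<le> N k q \<and>
      sqrt (real (N k q)) * dist_int (real y * (real q * \<theta>1) - t) < e k / sqrt (real q)"
    by blast+
  \<comment> \<open>The factor \<open>N\<close> absorbs the multiplier \<open>y \<le> N\<close>; the
    square root absorbs \<open>sqrt x \<le> sqrt (q * N)\<close> for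
    \<open>x = y * q\<close>.\<close>
  define \<delta> where "\<delta> k q = e k / (real (N k q) * sqrt (real q * real (N k q)))" for k q
  \<comment> \<open>All solutions \<open>\<theta>2\<close> of an integer relation with
    \<open>c \<noteq> 0\<close>. For \<open>c = 0\<close> the quotient is 0, which the triple
    \<open>(0, 0, 1)\<close> gives as well.\<close>
  define X where "X = (\<lambda>(a, b, c). - (of_int a + of_int b * \<theta>1) / of_int c) ` (UNIV :: (int \<times> int \<times> int) set)"
  have "countable X" by (simp add: X_def)
  moreover have "0 < \<delta> k q" if "0 < q" for k q
    using N(1)[OF that] that by (simp add: \<delta>_def e_def)
  ultimately obtain \<theta>2 where \<theta>2: "\<theta>2 \<notin> X" "\<And>k. \<exists>q>0. \<exists>p. \<bar>real q * \<theta>2 - of_int p\<bar> < \<delta> k q"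
    using exists_Liouville_avoiding_countable by metis
  show thesis
  proof (rule that)
    fix a b c :: int
    assume rel: "of_int a + of_int b * \<theta>1 + of_int c * \<theta>2 = 0"
    have "c = 0"
    proof (rule ccontr)
      assume "c \<noteq> 0"
      with rel have "\<theta>2 = - (of_int a + of_int b * \<theta>1) / of_int c"
        by (simp add: field_simps)
      then have "\<theta>2 \<in> X" unfolding X_def by (intro image_eqI[of _ _ "(a, b, c)"]) simp_all
      with \<theta>2(1) show False by contradiction
    qed
    moreover have "b = 0"
    proof (rule ccontr)
      assume "b \<noteq> 0"
      with rel \<open>c = 0\<close> have "\<theta>1 = of_int (- a) / of_int b"
        by (simp add: field_simps)
      then show False using irr by (metis Rats_divide Rats_of_int)
    qed
    ultimately show "a = 0 \<and> b = 0 \<and> c = 0" using rel by simp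
  next
    fix \<theta> \<eta> :: "real ^ 2"
    assume \<theta>: "\<theta> $ 1 = \<theta>1" "\<theta> $ 2 = \<theta>2" and \<eta>: "\<eta> $ 2 = 0"
    show "\<eta> \<notin> Bad \<theta>"
    proof (rule notin_Bad)
      fix \<epsilon> :: real
      assume "0 < \<epsilon>"
      then obtain k where k: "e k < \<epsilon>"
        unfolding e_def using nat_approx_posE by metis
      obtain q p where q: "q > 0" "\<bar>real q * \<theta>2 - of_int p\<bar> < \<delta> k q"
        using \<theta>2(2) by blast
      obtain y where y: "1 \<le> y" "y \<le> N k q"
        "sqrt (real (N k q)) * dist_int (real y * (real q * \<theta>1) - \<eta> $ 1) < e k / sqrt (real q)"
        using N(2)[OF q(1)] by blast
      define x where "x = y * q"
      have sq: "sqrt (real x) \<le> sqrt (real q) * sqrt (real (N k q))"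
        using y by (simp add: x_def real_sqrt_mult mult.commute mult_left_mono)
      have "sqrt (real x) * dist_int (real x * \<theta>1 - \<eta> $ 1)
          \<le> sqrt (real q) * sqrt (real (N k q)) * dist_int (real x * \<theta>1 - \<eta> $ 1)"
        using sq by (intro mult_right_mono dist_int_nonneg)
      also have "\<dots> < e k"
        using y(3) q(1) by (simp add: x_def field_simps)
      finally have 1: "sqrt (real x) * dist_int (real x * \<theta>1 - \<eta> $ 1) < \<epsilon>" using k by simp
      have "dist_int (real x * \<theta>2) \<le> \<bar>real x * \<theta>2 - of_int (int y * p)\<bar>"
        by (rule dist_int_le)
      also have "real x * \<theta>2 - of_int (int y * p) = real y * (real q * \<theta>2 - of_int p)"
        by (simp add: x_def algebra_simps)
      also have "\<bar>\<dots>\<bar> = real y * \<bar>real q * \<theta>2 - of_int p\<bar>"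
        by (simp add: abs_mult)
      also have "\<dots> \<le> real (N k q) * \<delta> k q"
        using y q by (intro mult_mono) auto
      also have "\<dots> = e k / (sqrt (real q) * sqrt (real (N k q)))"
        using N(1)[OF q(1)] by (simp add: \<delta>_def real_sqrt_mult)
      finally have "sqrt (real x) * dist_int (real x * \<theta>2)
          \<le> sqrt (real q) * sqrt (real (N k q)) * (e k / (sqrt (real q) * sqrt (real (N k q))))"
        using sq by (intro mult_mono dist_int_nonneg) auto
      also have "\<dots> = e k" using q(1) N(1)[OF q(1)] by simp
      finally have 2: "sqrt (real x) * dist_int (real x * \<theta>2) < \<epsilon>" using k by simp
      show "\<exists>x\<ge>1. sqrt (real x) * dist_int (real x * \<theta> $ 1 - \<eta> $ 1) < \<epsilon>
          \<and> sqrt (real x) * dist_int (real x * \<theta> $ 2 - \<eta> $ 2) < \<epsilon>"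
        using 1 2 \<theta> \<eta> y(1) q(1) by (intro exI[of _ x]) (simp add: x_def)
    qed
  qed
qed

section \<open>Failure of the winning property on the missed line\<close>

theorem theorem3p1:
  shows "\<exists>\<theta> :: real ^ 2.
     (\<forall>a b c :: int. of_int a + of_int b * \<theta> $ 1 + of_int c * \<theta> $ 2 = 0 \<longrightarrow>
        a = 0 \<and> b = 0 \<and> c = 0) \<and>
     \<not> isotropically_winning (Bad \<theta>)"
proof -
  have "\<not> (UNIV :: real set) \<subseteq> \<rat>"
    using countable_rat uncountable_UNIV_real countable_subset by blast
  then obtain \<theta>1 :: real where "\<theta>1 \<notin> \<rat>" by blast
  then obtain \<theta>2 where indep: "\<And>a b c :: int. of_int a + of_int b * \<theta>1 + of_int c * \<theta>2 = 0 \<Longrightarrow> a = 0 \<and> b = 0 \<and> c = 0"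
    and disj: "\<And>\<theta> \<eta>. \<theta> $ 1 = \<theta>1 \<Longrightarrow> \<theta> $ 2 = \<theta>2 \<Longrightarrow> \<eta> $ 2 = 0 \<Longrightarrow> \<eta> \<notin> Bad \<theta>"
    using exists_independent_Bad_disjoint_line by blast
  define \<theta> :: "real ^ 2" where "\<theta> = vector [\<theta>1, \<theta>2]"
  \<comment> \<open>The line is written as a hyperplane with normal \<open>axis 2 1\<close>, which
    gives affinity and dimension at once.\<close>
  define L :: "(real ^ 2) set" where "L = {\<eta>. axis 2 1 \<bullet> \<eta> = 0}"
  have mem_L: "\<eta> \<in> L \<longleftrightarrow> \<eta> $ 2 = 0" for \<eta>
    by (simp add: L_def inner_axis')
  have "affine L" unfolding L_def by (rule affine_hyperplane)
  moreover have "aff_dim L = 1"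
    unfolding L_def by (subst aff_dim_hyperplane) (simp_all add: axis_eq_0_iff)
  moreover have "Bad \<theta> \<inter> L = {}"
    using disj[of \<theta>] by (auto simp: mem_L \<theta>_def)
  \<comment> \<open>Being 1/2-winning requires every \<open>\<beta>\<close>, so failure at the
    single value 1/2 suffices.\<close>
  moreover have "\<not> alpha_beta_winning (1/2) (1/2) L {}"
    by (rule not_alpha_beta_winning_empty[where a = 0 and b = "axis 1 1"])
       (use \<open>affine L\<close> in \<open>auto simp: mem_L axis_def vec_eq_iff\<close>)
  ultimately have "\<not> isotropically_winning (Bad \<theta>)"
    unfolding isotropically_winning_def alpha_winning_def
    by (intro notI) (auto dest!: spec[of _ 1] spec[of _ L] spec[of _ "1/2"])
  then show ?thesis
    using indep by (intro exI[of _ \<theta>]) (simp add: \<theta>_def)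
qed

end
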